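(* Let $k$ be a perfect field, let $A$ and $B$ be finite-dimensional semisimple associative $k$-algebras and let $M\ne 0$ be a finite-dimensional $(A,B)$-bimodule. Then the canonical filtration of the triangular algebra $T:=T(A,M,B)$ is given by $$F(T)^{\mathrm{Can}}_n=\begin{cases} T & n\le 0,\\ M & n=1,\\ 0 & n>1.\end{cases}$$
   Context: The triangular algebra is $T(A,M,B)=\left\{\begin{bmatrix} a & m\\ 0 & b\end{bmatrix}: a\in A,\ b\in B,\ m\in M\right\}$ with multiplication $\begin{bmatrix} a & m\\ 0 & b\end{bmatrix}\begin{bmatrix} a' & m'\\ 0 & b'\end{bmatrix}=\begin{bmatrix} aa' & am'+mb'\\ 0 & bb'\end{bmatrix}$; $M$ is identified with the matrices having $a=0$, $b=0$. An associative algebra $A$ (possibly non-unital) is semisimple if its Jacobson radical $J(A)$ is zero, where $J(A)=\{x\in A\mid \text{every element } z \text{ of } Ax \text{ is left quasi-regular, i.e. } y+z-yz=0 \text{ for some } y\in A\}$. A filtration $F_\bullet$ of a finite-dimensional associative algebra $R$ is a family of $k$-subspaces $F_m\subseteq R$, $m\in\mathbb{Z}$, such that $F_i\supseteq F_j$ when $i\le j$; $F_iF_j\subseteq F_{i+j}$ for all $i,j$; $F_i=R$ for $i\ll0$ and $F_i=0$ for $i\gg0$. The trivial filtration has $F_n=R$ for $n\le 0$ and $F_n=0$ for $n>0$. The weights of $F_\bullet$ are the integers $m$ with $F_m\ne F_{m+1}$. Set $$\mathrm{wt}(R,F_\bullet)=\sum_m m\dim(F_m/F_{m+1}),\quad \|F_\bullet\|=\Big(\sum_m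 m^2\dim(F_m/F_{m+1})\Big)^{1/2},\quad \nu(R,F_\bullet)=\frac{-\mathrm{wt}(R,F_\bullet)}{\|F_\bullet\|}$$ ($\nu$ for non-trivial $F_\bullet$). $R$ is semistable if $-\mathrm{wt}(R,F_\bullet)\ge0$ for all filtrations, and unstable otherwise. The canonical filtration $F(R)^{\mathrm{Can}}_\bullet$ is the trivial filtration if $R$ is semistable, and if $R$ is unstable it is the filtration minimizing $\nu(R,-)$, which exists and is unique up to positive rescaling of the weights by a theorem of Kempf. Equalities describing canonical filtrations are understood up to positive rescaling of the weights. *)

theory Defs
  imports "HOL-Analysis.Product_Vector"
begin

definition perfect_field :: "'k::field itself \<Rightarrow> bool" where
  "perfect_field _ \<longleftrightarrow> CHAR('k) = 0 \<or> surj (\<lambda>x::'k. x ^ CHAR('k))"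

definition fin_dim :: "('k::field \<Rightarrow> 'a::ab_group_add \<Rightarrow> 'a) \<Rightarrow> bool" where
  "fin_dim sc \<longleftrightarrow> (\<exists>Basis. finite_dimensional_vector_space sc Basis)"

text \<open>
  Algebras need not have a unit. The product is a parameter rather than the type-class
  operation, because the product of a triangular algebra depends on the two module actions.
\<close>

locale assoc_algebra = vector_space scale
  for scale :: "'k::field \<Rightarrow> 'a::ab_group_add \<Rightarrow> 'a" (infixr \<open>*s\<close> 75) +
  fixes mult :: "'a \<Rightarrow> 'a \<Rightarrow> 'a" (infixl \<open>\<cdot>\<close> 70)
  assumes mult_assoc: "(x \<cdot> y) \<cdot> z = x \<cdot> (y \<cdot> z)"
    and mult_add_left: "(x + y) \<cdot> z = x \<cdot> z + y \<cdot> z"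
    and mult_add_right: "x \<cdot> (y + z) = x \<cdot> y + x \<cdot> z"
    and mult_scale_left: "(c *s x) \<cdot> y = c *s (x \<cdot> y)"
    and mult_scale_right: "x \<cdot> (c *s y) = c *s (x \<cdot> y)"
begin

definition left_quasi_regular :: "'a \<Rightarrow> bool" where
  "left_quasi_regular z \<longleftrightarrow> (\<exists>y. y + z - y \<cdot> z = 0)"

definition jacobson_radical :: "'a set" where
  "jacobson_radical = {x. \<forall>z \<in> range (\<lambda>a. a \<cdot> x). left_quasi_regular z}"

definition semisimple :: bool where
  "semisimple \<longleftrightarrow> jacobson_radical = {0}"

end

locale fd_algebra = assoc_algebra scale mult
  for scale :: "'k::field \<Rightarrow> 'a::ab_group_add \<Rightarrow> 'a" (infixr \<open>*s\<close> 75)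
    and mult :: "'a \<Rightarrow> 'a \<Rightarrow> 'a" (infixl \<open>\<cdot>\<close> 70) +
  assumes fin_dim: "fin_dim scale"
begin

definition filtration :: "(int \<Rightarrow> 'a set) \<Rightarrow> bool" where
  "filtration F \<longleftrightarrow>
     (\<forall>m. subspace (F m)) \<and>
     (\<forall>i j. i \<le> j \<longrightarrow> F j \<subseteq> F i) \<and>
     (\<forall>i j. \<forall>x \<in> F i. \<forall>y \<in> F j. x \<cdot> y \<in> F (i + j)) \<and>
     (\<exists>N. \<forall>i \<le> N. F i = UNIV) \<and>
     (\<exists>N. \<forall>i \<ge> N. F i = {0})"

definition trivial_filtration :: "int \<Rightarrow> 'a set" where
  "trivial_filtration n = (if n \<le> 0 then UNIV else {0})"

definition weights :: "(int \<Rightarrow> 'a set) \<Rightarrow> int set" where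
  "weights F = {m. F m \<noteq> F (m + 1)}"

text \<open>The dimension of the quotient \<open>F m / F (m + 1)\<close>; for a filtration \<open>F (m + 1) \<subseteq> F m\<close>.\<close>

definition gr_dim :: "(int \<Rightarrow> 'a set) \<Rightarrow> int \<Rightarrow> int" where
  "gr_dim F m = int (dim (F m)) - int (dim (F (m + 1)))"

text \<open>
  The summands of \<open>wt\<close> and \<open>filt_norm\<close> vanish outside \<open>weights F\<close>, which is finite for a
  filtration.
\<close>

definition wt :: "(int \<Rightarrow> 'a set) \<Rightarrow> int" where
  "wt F = (\<Sum>m \<in> weights F. m * gr_dim F m)"

definition filt_norm :: "(int \<Rightarrow> 'a set) \<Rightarrow> real" where
  "filt_norm F = sqrt (of_int (\<Sum>m \<in> weights F. m\<^sup>2 * gr_dim F m))"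

definition \<nu> :: "(int \<Rightarrow> 'a set) \<Rightarrow> real" where
  "\<nu> F = - of_int (wt F) / filt_norm F"

definition semistable :: bool where
  "semistable \<longleftrightarrow> (\<forall>F. filtration F \<longrightarrow> - wt F \<ge> 0)"

text \<open>
  For an unstable algebra this predicate describes a class of filtrations closed under
  positive rescaling of the weights.
\<close>

definition canonical_filtration :: "(int \<Rightarrow> 'a set) \<Rightarrow> bool" where
  "canonical_filtration F \<longleftrightarrow>
     (if semistable then F = trivial_filtration
      else filtration F \<and> F \<noteq> trivial_filtration \<and>
           (\<forall>G. filtration G \<and> G \<noteq> trivial_filtration \<longrightarrow> \<nu> F \<le> \<nu> G))"

end

text \<open>
  A filtration \<open>F\<close> extends to real indices by \<open>F\<^sub>t = F \<lceil>t\<rceil>\<close>, with jumps at the same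
  weights. So \<open>G\<close> is obtained from \<open>F\<close> by multiplying all weights by some \<open>c > 0\<close> iff
  the real-indexed families satisfy \<open>G\<^sub>c\<^sub>t = F\<^sub>t\<close>.
\<close>

definition rescaling :: "(int \<Rightarrow> 'a set) \<Rightarrow> (int \<Rightarrow> 'a set) \<Rightarrow> bool" where
  "rescaling F G \<longleftrightarrow> (\<exists>c > 0. \<forall>t::real. G \<lceil>c * t\<rceil> = F \<lceil>t\<rceil>)"

text \<open>The actions are not assumed to be unital.\<close>

locale bimodule =
  A: assoc_algebra scaleA multA + B: assoc_algebra scaleB multB + M: vector_space scaleM
  for scaleA :: "'k::field \<Rightarrow> 'a::ab_group_add \<Rightarrow> 'a" and multA :: "'a \<Rightarrow> 'a \<Rightarrow> 'a"
    and scaleB :: "'k \<Rightarrow> 'b::ab_group_add \<Rightarrow> 'b" and multB :: "'b \<Rightarrow> 'b \<Rightarrow> 'b"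
    and scaleM :: "'k \<Rightarrow> 'm::ab_group_add \<Rightarrow> 'm" +
  fixes lact :: "'a \<Rightarrow> 'm \<Rightarrow> 'm" and ract :: "'m \<Rightarrow> 'b \<Rightarrow> 'm"
  assumes lact_mult: "lact (multA a a') m = lact a (lact a' m)"
    and lact_add_left: "lact (a + a') m = lact a m + lact a' m"
    and lact_add_right: "lact a (m + m') = lact a m + lact a m'"
    and lact_scale_left: "lact (scaleA c a) m = scaleM c (lact a m)"
    and lact_scale_right: "lact a (scaleM c m) = scaleM c (lact a m)"
    and ract_mult: "ract m (multB b b') = ract (ract m b) b'"
    and ract_add_left: "ract (m + m') b = ract m b + ract m' b"
    and ract_add_right: "ract m (b + b') = ract m b + ract m b'"
    and ract_scale_left: "ract (scaleM c m) b = scaleM c (ract m b)"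
    and ract_scale_right: "ract m (scaleB c b) = scaleM c (ract m b)"
    and lact_ract: "ract (lact a m) b = lact a (ract m b)"

text \<open>
  The triple \<open>(a, m, b)\<close> stands for the upper triangular matrix with diagonal entries
  \<open>a\<close>, \<open>b\<close> and off-diagonal entry \<open>m\<close>.
\<close>

definition tri_scale ::
  "('k \<Rightarrow> 'a \<Rightarrow> 'a) \<Rightarrow> ('k \<Rightarrow> 'm \<Rightarrow> 'm) \<Rightarrow> ('k \<Rightarrow> 'b \<Rightarrow> 'b) \<Rightarrow> 'k \<Rightarrow> 'a \<times> 'm \<times> 'b \<Rightarrow> 'a \<times> 'm \<times> 'b"
  where "tri_scale scaleA scaleM scaleB c = (\<lambda>(a, m, b). (scaleA c a, scaleM c m, scaleB c b))"

definition tri_mult ::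
  "('a \<Rightarrow> 'a \<Rightarrow> 'a) \<Rightarrow> ('a \<Rightarrow> 'm::plus \<Rightarrow> 'm) \<Rightarrow> ('m \<Rightarrow> 'b \<Rightarrow> 'm) \<Rightarrow> ('b \<Rightarrow> 'b \<Rightarrow> 'b) \<Rightarrow>
   'a \<times> 'm \<times> 'b \<Rightarrow> 'a \<times> 'm \<times> 'b \<Rightarrow> 'a \<times> 'm \<times> 'b"
  where "tri_mult multA lact ract multB =
    (\<lambda>(a, m, b) (a', m', b'). (multA a a', lact a m' + ract m b', multB b b'))"

definition tri_M :: "('a::zero \<times> 'm \<times> 'b::zero) set" where
  "tri_M = {(0, m, 0) | m. True}"

lemma (in bimodule) assoc_algebra_tri:
  "assoc_algebra (tri_scale scaleA scaleM scaleB) (tri_mult multA lact ract multB)"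
  by unfold_locales
    (auto simp: tri_scale_def tri_mult_def plus_prod_def algebra_simps
      A.mult_assoc A.mult_add_left A.mult_add_right A.mult_scale_left A.mult_scale_right
      B.mult_assoc B.mult_add_left B.mult_add_right B.mult_scale_left B.mult_scale_right
      A.scale_right_distrib B.scale_right_distrib M.scale_right_distrib
      A.scale_left_distrib B.scale_left_distrib M.scale_left_distrib
      lact_mult lact_add_left lact_add_right lact_scale_left lact_scale_right
      ract_mult ract_add_left ract_add_right ract_scale_left ract_scale_right lact_ract)

lemma (in bimodule) fd_algebra_tri:
  assumes "fin_dim scaleA" "fin_dim scaleM" "fin_dim scaleB"
  shows "fd_algebra (tri_scale scaleA scaleM scaleB) (tri_mult multA lact ract multB)"
proof -
  obtain BA where BA: "finite_dimensional_vector_space scaleA BA"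
    using assms by (auto simp: fin_dim_def)
  obtain BM where BM: "finite_dimensional_vector_space scaleM BM"
    using assms by (auto simp: fin_dim_def)
  obtain BB where BB: "finite_dimensional_vector_space scaleB BB"
    using assms by (auto simp: fin_dim_def)
  interpret fA: finite_dimensional_vector_space scaleA BA by (fact BA)
  interpret fM: finite_dimensional_vector_space scaleM BM by (fact BM)
  interpret fB: finite_dimensional_vector_space scaleB BB by (fact BB)
  interpret MB: finite_dimensional_vector_space_prod scaleM scaleB BM BB
    by unfold_locales
  interpret AMB: finite_dimensional_vector_space_prod scaleA MB.scale BA MB.Basis_pair
    by unfold_locales
  have "tri_scale scaleA scaleM scaleB = AMB.scale"
    by (auto simp: fun_eq_iff tri_scale_def AMB.scale_def MB.scale_def)
  moreover have "finite_dimensional_vector_space AMB.scale AMB.Basis_pair"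
    by unfold_locales
  ultimately have "fin_dim (tri_scale scaleA scaleM scaleB)"
    by (auto simp: fin_dim_def)
  then show ?thesis
    by (intro fd_algebra.intro assoc_algebra_tri fd_algebra_axioms.intro)
qed

end

theory Submission
  imports Defs
begin

text \<open>
  Let \<open>F\<close> be a filtration of the triangular algebra \<open>T\<close>. Its weights are distributed over the
  ideal \<open>M\<close> (filtered by the \<open>F n \<inter> M\<close>) and the quotient \<open>T / M\<close>, which is the semisimple algebra
  \<open>A \<times> B\<close>. Both \<open>wt\<close> and the square of the norm are sums of the two contributions. On \<open>M\<close> the
  Cauchy-Schwarz inequality bounds the weight by \<open>sqrt (dim M)\<close> times the norm, with equality only
  if a single weight occurs. The filtration of \<open>A \<times> B\<close> cannot help, because its weight is never
  positive. Hence \<open>\<nu> F \<ge> - sqrt (dim M)\<close>, and equality means that \<open>A \<times> B\<close> has only the weight 0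
  and \<open>M\<close> has only one weight \<open>w > 0\<close>. Then \<open>F\<close> is \<open>T\<close> up to index 0, \<open>M\<close> from 1 to \<open>w\<close>, and 0
  afterwards, which is a rescaling of the filtration with \<open>w = 1\<close>. This is
  \<open>square_zero_ideal.canonical_filtration_iff\<close>.

  What remains is the semistability of a semisimple algebra \<open>R\<close>. For a filtration \<open>F\<close> of \<open>R\<close>, the
  set \<open>F 1\<close> is nilpotent. There is a linear form \<open>l\<close> on \<open>R\<close> that vanishes on \<open>F 1\<close> and for which
  the bilinear form \<open>l (x \<cdot> y)\<close> is nondegenerate (\<open>frobenius_form_vanishing_on_nilpotent\<close>). Because
  \<open>F m \<cdot> F (1 - m)\<close> is contained in \<open>F 1\<close>, the subspaces \<open>F m\<close> and \<open>F (1 - m)\<close> are orthogonal, so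
  their dimensions add up to at most \<open>dim R\<close>. Summation by parts expresses the weight of \<open>F\<close> as
  the sum over \<open>m \<ge> 1\<close> of \<open>dim (F m) + dim (F (1 - m)) - dim R\<close>, which is therefore at most 0.
\<close>

section \<open>Algebras without nilpotent one-sided ideals\<close>

context assoc_algebra
begin

lemma mult_zero [simp]: "x \<cdot> 0 = 0" "0 \<cdot> x = 0"
  using mult_add_right[of x 0 0] mult_add_left[of 0 0 x] by simp_all

lemma mult_minus: "x \<cdot> (- y) = - (x \<cdot> y)" "(- x) \<cdot> y = - (x \<cdot> y)"
  using mult_add_right[of x y "- y"] mult_add_left[of x "- x" y]
  by (simp_all add: eq_neg_iff_add_eq_0 add.commute)

lemma mult_diff: "x \<cdot> (y - z) = x \<cdot> y - x \<cdot> z" "(x - y) \<cdot> z = x \<cdot> z - y \<cdot> z"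
  using mult_add_right[of x y "- z"] mult_add_left[of x "- y" z] by (simp_all add: mult_minus)

definition subalgebra :: "'a set \<Rightarrow> bool" where
  "subalgebra S \<longleftrightarrow> subspace S \<and> (\<forall>x\<in>S. \<forall>y\<in>S. x \<cdot> y \<in> S)"

definition semiprime :: "'a set \<Rightarrow> bool" where
  "semiprime S \<longleftrightarrow> (\<forall>a\<in>S. (\<forall>r\<in>S. a \<cdot> r \<cdot> a = 0) \<longrightarrow> a = 0)"

definition right_ideal :: "'a set \<Rightarrow> 'a set \<Rightarrow> bool" where
  "right_ideal S I \<longleftrightarrow> subspace I \<and> I \<subseteq> S \<and> (\<forall>x\<in>I. \<forall>s\<in>S. x \<cdot> s \<in> I)"

text \<open>
  Products of elements of \<open>N\<close> are applied to \<open>S\<close>, so that the condition can be followed when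
  both \<open>N\<close> and \<open>S\<close> are cut down by an idempotent.
\<close>

definition acts_nilpotently :: "'a set \<Rightarrow> 'a set \<Rightarrow> bool" where
  "acts_nilpotently N S \<longleftrightarrow>
     (\<exists>n. \<forall>xs. set xs \<subseteq> N \<longrightarrow> length xs = n \<longrightarrow> (\<forall>y\<in>S. foldr (\<cdot>) xs y = 0))"

abbreviation linear_form :: "('a \<Rightarrow> 'k) \<Rightarrow> bool" where
  "linear_form \<equiv> Vector_Spaces.linear scale (*)"

lemma field_vector_space: "vector_space ((*) :: 'k \<Rightarrow> 'k \<Rightarrow> 'k)"
  by unfold_locales (simp_all add: algebra_simps)

lemma linear_formI:
  assumes "\<And>x y. l (x + y) = l x + l y" and "\<And>c x. l (c *s x) = c * l x"
  shows "linear_form l"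
  unfolding Vector_Spaces.linear_iff
  using assms vector_space_axioms field_vector_space by auto

lemma linear_form_simps:
  assumes "linear_form l"
  shows "l (x + y) = l x + l y" and "l (x - y) = l x - l y" and "l (c *s x) = c * l x"
    and "l 0 = 0"
proof -
  interpret l: Vector_Spaces.linear scale "(*)" l by (fact assms)
  show "l (x + y) = l x + l y" "l (x - y) = l x - l y" "l (c *s x) = c * l x" "l 0 = 0"
    by (simp_all add: l.add l.diff l.scale)
qed

lemma linear_form_exists:
  assumes "f \<noteq> 0"
  shows "\<exists>l. linear_form l \<and> l f = 1"
proof -
  interpret p: vector_space_pair scale "(*) :: 'k \<Rightarrow> 'k \<Rightarrow> 'k"
    by (intro vector_space_pair.intro vector_space_axioms field_vector_space)
  show ?thesis
    using p.linear_independent_extend[of "{f}" "\<lambda>_. 1"] assms by auto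
qed

text \<open>
  If \<open>a \<cdot> r \<cdot> a = 0\<close> for all \<open>r\<close>, then every element of the left ideal generated by \<open>a\<close>
  squares to zero, and an element \<open>z\<close> with \<open>z \<cdot> z = 0\<close> has the quasi-inverse \<open>- z\<close>.
\<close>

lemma semisimple_imp_semiprime:
  assumes "semisimple"
  shows "semiprime UNIV"
  unfolding semiprime_def
proof (intro ballI impI)
  fix a assume a: "\<forall>r\<in>UNIV. a \<cdot> r \<cdot> a = 0"
  have "left_quasi_regular (r \<cdot> a)" for r
  proof -
    have "(r \<cdot> a) \<cdot> (r \<cdot> a) = r \<cdot> (a \<cdot> r \<cdot> a)" by (simp add: mult_assoc)
    then show ?thesis
      unfolding left_quasi_regular_def using a
      by (intro exI[of _ "- (r \<cdot> a)"]) (simp add: mult_minus)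
  qed
  then have "a \<in> jacobson_radical" by (auto simp: jacobson_radical_def)
  then show "a = 0" using assms by (simp add: semisimple_def)
qed

lemma right_ideal_translate:
  assumes I: "right_ideal S I" and J: "right_ideal S J" and a: "a \<in> I"
  shows "right_ideal S ((\<lambda>y. a \<cdot> y) ` J)" and "(\<lambda>y. a \<cdot> y) ` J \<subseteq> I"
proof -
  show sub: "(\<lambda>y. a \<cdot> y) ` J \<subseteq> I" using assms by (auto simp: right_ideal_def)
  have "subspace ((\<lambda>y. a \<cdot> y) ` J)"
    using J unfolding right_ideal_def subspace_def
    by (auto simp: image_iff) (metis mult_zero(1), metis mult_add_right, metis mult_scale_right)
  then show "right_ideal S ((\<lambda>y. a \<cdot> y) ` J)"
    using sub I J unfolding right_ideal_def by (auto simp: image_iff) (metis mult_assoc)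
qed

text \<open>
  As in Engel's theorem: apply elements of \<open>N\<close> to \<open>y\<close> as long as the result is nonzero;
  this stops after fewer than \<open>n\<close> steps.
\<close>

lemma common_annihilated_vector:
  assumes "\<And>xs y. set xs \<subseteq> N \<Longrightarrow> length xs = n \<Longrightarrow> y \<in> S \<Longrightarrow> foldr (\<cdot>) xs y = 0"
    and "subalgebra S" "N \<subseteq> S" "y \<in> S" "y \<noteq> 0"
  shows "\<exists>z\<in>S. z \<noteq> 0 \<and> (\<forall>x\<in>N. x \<cdot> z = 0)"
proof -
  have "(\<And>xs. set xs \<subseteq> N \<Longrightarrow> length xs = n \<Longrightarrow> foldr (\<cdot>) xs y = 0) \<Longrightarrow> ?thesis"
    using assms(4,5)
  proof (induction n arbitrary: y)
    case 0
    then show ?case using "0.prems"(1)[of "[]"] by simp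
  next
    case (Suc n)
    show ?case
    proof (cases "\<forall>x\<in>N. x \<cdot> y = 0")
      case True
      then show ?thesis using Suc.prems by auto
    next
      case False
      then obtain x where x: "x \<in> N" "x \<cdot> y \<noteq> 0" by auto
      have "x \<cdot> y \<in> S" using x Suc.prems assms(2,3) by (auto simp: subalgebra_def)
      moreover have "foldr (\<cdot>) xs (x \<cdot> y) = 0" if "set xs \<subseteq> N" "length xs = n" for xs
        using Suc.prems(1)[of "xs @ [x]"] that x by simp
      ultimately show ?thesis using Suc.IH x by blast
    qed
  qed
  then show ?thesis using assms(1,4) by blast
qed

end

sublocale fd_algebra \<subseteq> finite_dimensional_vector_space scale
    "SOME Basis. finite_dimensional_vector_space scale Basis"
  using someI_ex[OF fin_dim[unfolded fin_dim_def]] .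

context fd_algebra
begin

text \<open>
  Brauer's lemma. A right ideal \<open>I \<noteq> 0\<close> of least dimension inside \<open>K\<close> has only the trivial
  right ideals below it. Semiprimeness provides an \<open>a\<close> in \<open>I\<close> with \<open>a \<cdot> I \<noteq> 0\<close>, so that
  \<open>I = a \<cdot> I\<close>, and an element of \<open>I\<close> fixing \<open>a\<close> from the right is an idempotent. The last
  property says that the right ideal generated by \<open>f\<close> is minimal.
\<close>

lemma generating_idempotent:
  assumes S: "subalgebra S" and sp: "semiprime S" and K: "right_ideal S K" and "K \<noteq> {0}"
  obtains f where "f \<in> K" "f \<cdot> f = f" "f \<noteq> 0"
    "\<And>s. s \<in> S \<Longrightarrow> f \<cdot> s \<noteq> 0 \<Longrightarrow> \<exists>t\<in>S. f \<cdot> s \<cdot> t = f"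
proof -
  define P where "P I \<longleftrightarrow> right_ideal S I \<and> I \<subseteq> K \<and> I \<noteq> {0}" for I
  have "P K" using assms by (auto simp: P_def)
  then obtain I where I: "P I" and Imin: "\<And>J. P J \<Longrightarrow> dim I \<le> dim J"
    using ex_has_least_nat[of P K dim] by blast
  have IS: "right_ideal S I" and IK: "I \<subseteq> K" and I0: "I \<noteq> {0}" using I by (auto simp: P_def)
  have sub: "subspace I" and ISS: "I \<subseteq> S" using IS by (auto simp: right_ideal_def)
  have min: "J = I" if J: "right_ideal S J" "J \<subseteq> I" "x \<in> J" "x \<noteq> 0" for J x
  proof -
    have "P J" using J IK by (auto simp: P_def)
    then have "dim I \<le> dim J" by (rule Imin)
    then show ?thesis using subspace_dim_equal[of J I] J sub by (auto simp: right_ideal_def)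
  qed
  have SS: "right_ideal S S" using S by (auto simp: right_ideal_def subalgebra_def)
  obtain x where x: "x \<in> I" "x \<noteq> 0" using I0 sub subspace_0 by blast
  then obtain r where r: "r \<in> S" "x \<cdot> r \<cdot> x \<noteq> 0" using sp ISS by (auto simp: semiprime_def)
  define a where "a = x \<cdot> r"
  have a: "a \<in> I" using IS x r by (auto simp: a_def right_ideal_def)
  have "(\<lambda>y. a \<cdot> y) ` I = I"
    using min[OF right_ideal_translate[OF IS IS a], of "a \<cdot> x"] x r by (auto simp: a_def)
  then obtain f where f: "f \<in> I" "a \<cdot> f = a" using a by (metis imageE)
  \<comment> \<open>Left multiplication by \<open>a\<close> is injective on \<open>I\<close>, as its kernel is a right ideal.\<close>
  define Z where "Z = {y \<in> I. a \<cdot> y = 0}"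
  have Z: "right_ideal S Z"
    using sub IS unfolding Z_def right_ideal_def subspace_def
    by (auto simp: mult_add_right mult_scale_right) (simp flip: mult_assoc)
  have ann: "y = 0" if y: "y \<in> I" "a \<cdot> y = 0" for y
  proof (rule ccontr)
    assume "y \<noteq> 0"
    then have "Z = I" using min[OF Z, of y] y by (auto simp: Z_def)
    then show False using x r by (auto simp: Z_def a_def)
  qed
  have ff: "f \<cdot> f \<in> I" using f IS ISS by (auto simp: right_ideal_def)
  have "a \<cdot> (f \<cdot> f - f) = 0" using f by (simp add: mult_diff flip: mult_assoc)
  then have idem: "f \<cdot> f = f" using ann[of "f \<cdot> f - f"] ff f sub by (simp add: subspace_diff)
  have f0: "f \<noteq> 0" using f r by (auto simp: a_def)
  have "\<exists>t\<in>S. f \<cdot> s \<cdot> t = f" if s: "s \<in> S" "f \<cdot> s \<noteq> 0" for s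
  proof -
    define b where "b = f \<cdot> s"
    have b: "b \<in> I" "b \<noteq> 0" using IS f s by (auto simp: b_def right_ideal_def)
    then obtain t where t: "t \<in> S" "b \<cdot> t \<cdot> b \<noteq> 0" using sp ISS by (auto simp: semiprime_def)
    then have "b \<cdot> t \<noteq> 0" by auto
    then have "(\<lambda>y. b \<cdot> y) ` S = I"
      using min[OF right_ideal_translate[OF IS SS b(1)], of "b \<cdot> t"] t by blast
    then show ?thesis using f unfolding b_def by (metis imageE)
  qed
  then show ?thesis using that[of f] f IK idem f0 by blast
qed

text \<open>
  A semisimple algebra is a Frobenius algebra, and here the Frobenius form can moreover be made
  to vanish on a prescribed nilpotent set \<open>N\<close>. In a matrix algebra over a division ring \<open>D\<close>,
  with \<open>N\<close> strictly triangular, one may take a nonzero linear form of \<open>D\<close> applied to the sum of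
  the diagonal entries. The proof builds this form one diagonal entry at a time. Since \<open>N\<close>
  kills a nonzero right ideal, there is a minimal idempotent \<open>f\<close> with \<open>N \<cdot> f = 0\<close>. Let \<open>p\<close> be a
  linear form with \<open>p f = 1\<close>, and \<open>l'\<close> the form obtained by induction for the Peirce
  corner \<open>S' = (1 - f) S (1 - f)\<close> and the set \<open>N' = (1 - f) N\<close>. Then
  \<open>l z = p (f z f) + l' ((1 - f) z (1 - f))\<close> is the required form. The formal expressions with
  \<open>1 - f\<close> are to be multiplied out, as no unit is available.
\<close>

theorem frobenius_form_vanishing_on_nilpotent:
  assumes "subalgebra S" "semiprime S" "N \<subseteq> S" "acts_nilpotently N S"
  shows "\<exists>l. linear_form l \<and> (\<forall>n\<in>N. l n = 0) \<and>
             (\<forall>x\<in>S. (\<forall>y\<in>S. l (x \<cdot> y) = 0) \<longrightarrow> x = 0)"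
  using assms
proof (induction "dim S" arbitrary: S N rule: less_induct)
  case less
  note S = less.prems(1) and sp = less.prems(2) and N = less.prems(3)
  have subS: "subspace S" and mS: "\<And>x y. x \<in> S \<Longrightarrow> y \<in> S \<Longrightarrow> x \<cdot> y \<in> S"
    using S by (auto simp: subalgebra_def)
  show ?case
  proof (cases "S \<subseteq> {0}")
    case True
    then show ?thesis using N by (intro exI[of _ "\<lambda>_. 0"]) (auto intro: linear_formI)
  next
    case False
    obtain n where nil: "\<And>xs y. set xs \<subseteq> N \<Longrightarrow> length xs = n \<Longrightarrow> y \<in> S \<Longrightarrow> foldr (\<cdot>) xs y = 0"
      using less.prems(4) by (auto simp: acts_nilpotently_def)
    define K where "K = {z \<in> S. \<forall>x\<in>N. x \<cdot> z = 0}"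
    have K: "right_ideal S K"
      using subS mS unfolding K_def right_ideal_def subspace_def
      by (auto simp: mult_add_right mult_scale_right) (simp flip: mult_assoc)
    have "K \<noteq> {0}"
      using common_annihilated_vector[OF nil S N] False by (auto simp: K_def)
    then obtain f where f: "f \<in> K" "f \<cdot> f = f" "f \<noteq> 0"
      and gen: "\<And>s. s \<in> S \<Longrightarrow> f \<cdot> s \<noteq> 0 \<Longrightarrow> \<exists>t\<in>S. f \<cdot> s \<cdot> t = f"
      using generating_idempotent[OF S sp K] by blast
    have fS: "f \<in> S" and Nf: "\<And>x. x \<in> N \<Longrightarrow> x \<cdot> f = 0" using f(1) by (auto simp: K_def)
    have ff: "f \<cdot> (f \<cdot> y) = f \<cdot> y" for y using f(2) by (simp flip: mult_assoc)
    define S' where "S' = {x \<in> S. f \<cdot> x = 0 \<and> x \<cdot> f = 0}"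
    define N' where "N' = (\<lambda>x. x - f \<cdot> x) ` N"
    have S': "subalgebra S'"
      using subS mS unfolding S'_def subalgebra_def subspace_def
      by (auto simp: mult_add_right mult_scale_right mult_add_left mult_scale_left mult_assoc)
         (simp flip: mult_assoc)
    have sp': "semiprime S'"
      unfolding semiprime_def
    proof (intro ballI impI)
      fix a assume a: "a \<in> S'" and ara: "\<forall>r\<in>S'. a \<cdot> r \<cdot> a = 0"
      have af: "a \<cdot> f = 0" "f \<cdot> a = 0" "a \<in> S" using a by (auto simp: S'_def)
      have "a \<cdot> r \<cdot> a = 0" if r: "r \<in> S" for r
      proof -
        \<comment> \<open>The component \<open>(1 - f) r (1 - f)\<close> of \<open>r\<close> is the only one that \<open>a\<close> sees.\<close>
        define r' where "r' = (r - f \<cdot> r) - (r - f \<cdot> r) \<cdot> f"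
        have "r' \<in> S'"
          using r fS subS mS f(2) ff unfolding r'_def S'_def
          by (simp add: subspace_diff mult_diff mult_assoc)
        then have "a \<cdot> r' \<cdot> a = 0" using ara by blast
        moreover have "a \<cdot> r' \<cdot> a = a \<cdot> r \<cdot> a - (a \<cdot> f) \<cdot> r \<cdot> a - (a \<cdot> r \<cdot> (f \<cdot> a) - (a \<cdot> f) \<cdot> r \<cdot> (f \<cdot> a))"
          unfolding r'_def by (simp only: mult_diff mult_assoc)
        ultimately show ?thesis using af by simp
      qed
      then show "a = 0" using sp af by (auto simp: semiprime_def)
    qed
    have N': "N' \<subseteq> S'"
      using N fS subS mS Nf f(2) ff unfolding N'_def S'_def
      by (auto simp: subspace_diff mult_diff mult_assoc)
    have "acts_nilpotently N' S'"
      unfolding acts_nilpotently_def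
    proof (intro exI[of _ n] allI impI ballI)
      fix xs y assume xs: "set xs \<subseteq> N'" "length xs = n" and y: "y \<in> S'"
      have "xs \<in> lists (N')" using xs by auto
      then obtain ys where ys: "set ys \<subseteq> N" "xs = map (\<lambda>x. x - f \<cdot> x) ys"
        unfolding N'_def lists_image by (auto simp: in_lists_conv_set)
      have "foldr (\<cdot>) (map (\<lambda>x. x - f \<cdot> x) ys) y = foldr (\<cdot>) ys y - f \<cdot> foldr (\<cdot>) ys y"
        using ys(1)
      proof (induction ys)
        case Nil
        then show ?case using y by (simp add: S'_def)
      next
        case (Cons x ys)
        define Y where "Y = foldr (\<cdot>) ys y"
        have "x \<cdot> (f \<cdot> Y) = 0" using Nf[of x] Cons.prems by (simp flip: mult_assoc)
        then show ?case using Cons by (simp add: mult_diff mult_assoc flip: Y_def)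
      qed
      also have "\<dots> = 0" using nil[of ys y] xs ys y by (auto simp: S'_def)
      finally show "foldr (\<cdot>) xs y = 0" using ys by simp
    qed
    moreover have "dim S' < dim S"
    proof (rule dim_psubset)
      have "f \<notin> S'" using f by (auto simp: S'_def)
      then have "S' \<subset> S" using fS by (auto simp: S'_def)
      then show "span S' \<subset> span S"
        using S' subS by (simp add: subalgebra_def span_eq_iff[THEN iffD2])
    qed
    ultimately obtain l' where l': "linear_form l'" "\<And>x. x \<in> N' \<Longrightarrow> l' x = 0"
      and nd': "\<And>x. x \<in> S' \<Longrightarrow> (\<And>y. y \<in> S' \<Longrightarrow> l' (x \<cdot> y) = 0) \<Longrightarrow> x = 0"
      using less.hyps[OF _ S' sp' N'] by metis
    obtain p where p: "linear_form p" "p f = 1" using linear_form_exists[OF f(3)] by blast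
    note lin = linear_form_simps[OF l'(1)] linear_form_simps[OF p(1)]
    define l where "l z = p (f \<cdot> z \<cdot> f) + l' (z - f \<cdot> z - (z \<cdot> f - f \<cdot> z \<cdot> f))" for z
    have "linear_form l"
    proof (rule linear_formI)
      show "l (x + y) = l x + l y" for x y
        unfolding l_def by (simp add: mult_add_left mult_add_right lin)
      show "l (c *s x) = c * l x" for c x
        unfolding l_def
        by (simp add: mult_scale_left mult_scale_right lin algebra_simps)
    qed
    moreover have "l x = 0" if x: "x \<in> N" for x
    proof -
      have "x - f \<cdot> x \<in> N'" using x by (auto simp: N'_def)
      then have "l' (x - f \<cdot> x) = 0" by (rule l'(2))
      then show ?thesis using Nf[OF x] by (simp add: l_def mult_assoc lin(4,8) del: lin(2))
    qed
    moreover have "x = 0" if x: "x \<in> S" and lx: "\<And>y. y \<in> S \<Longrightarrow> l (x \<cdot> y) = 0" for x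
    proof -
      have fx: "f \<cdot> x = 0"
      proof (rule ccontr)
        assume "f \<cdot> x \<noteq> 0"
        then obtain t where t: "t \<in> S" "f \<cdot> x \<cdot> t = f" using gen x by blast
        have "l (x \<cdot> (t \<cdot> f)) = p (f \<cdot> x \<cdot> t \<cdot> f)"
          unfolding l_def by (simp add: mult_assoc f(2) lin)
        then show False using t lx[of "t \<cdot> f"] mS fS f p by simp
      qed
      have fxy: "f \<cdot> (x \<cdot> y) = 0" for y using fx by (simp flip: mult_assoc)
      \<comment> \<open>It remains to see that \<open>x \<cdot> u\<close> ends in \<open>f\<close>, because then \<open>f \<cdot> x = 0\<close> gives \<open>x \<cdot> u \<cdot> x = 0\<close>.\<close>
      have xu: "x \<cdot> u = x \<cdot> u \<cdot> f" if u: "u \<in> S" for u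
      proof -
        have "x \<cdot> u - x \<cdot> u \<cdot> f = 0"
        proof (rule nd')
          show "x \<cdot> u - x \<cdot> u \<cdot> f \<in> S'"
            using x u subS mS fS f(2) fxy by (simp add: S'_def subspace_diff mult_diff mult_assoc)
          fix v assume v: "v \<in> S'"
          then have vS: "v \<in> S" "f \<cdot> v = 0" "v \<cdot> f = 0" by (auto simp: S'_def)
          \<comment> \<open>On \<open>x \<cdot> (u \<cdot> v)\<close> both multiplications by \<open>f\<close> give zero, so \<open>l\<close> restricts to \<open>l'\<close> there.\<close>
          have "l (x \<cdot> (u \<cdot> v)) = l' (x \<cdot> (u \<cdot> v))"
            unfolding l_def by (simp add: mult_assoc fxy vS lin)
          then show "l' ((x \<cdot> u - x \<cdot> u \<cdot> f) \<cdot> v) = 0"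
            using lx[of "u \<cdot> v"] mS u vS by (simp add: mult_diff mult_assoc)
        qed
        then show ?thesis by simp
      qed
      have "x \<cdot> u \<cdot> x = 0" if "u \<in> S" for u
        using xu[OF that] fx by (metis mult_assoc mult_zero(1))
      then show "x = 0" using sp x by (auto simp: semiprime_def)
    qed
    ultimately show ?thesis by blast
  qed
qed

section \<open>Dimension estimates from a form\<close>

lemma dim_le_dim_kernels:
  assumes "finite C" "subspace V" "\<And>c. c \<in> C \<Longrightarrow> linear_form (l c)"
  shows "dim V \<le> dim {v \<in> V. \<forall>c\<in>C. l c v = 0} + card C"
  using assms
proof (induction C rule: finite_induct)
  case empty
  then show ?case by simp
next
  case (insert c C)
  define W where "W = {v \<in> V. \<forall>c\<in>C. l c v = 0}"
  define W' where "W' = {v \<in> V. \<forall>d\<in>insert c C. l d v = 0}"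
  have W: "subspace W"
    using insert.prems unfolding W_def subspace_def by (auto simp: linear_form_simps)
  have lc: "linear_form (l c)" using insert.prems by simp
  have W'W: "W' = {v \<in> W. l c v = 0}" by (auto simp: W_def W'_def)
  have "dim W \<le> dim W' + 1"
  proof (cases "\<forall>v\<in>W. l c v = 0")
    case True
    then have "W' = W" by (auto simp: W'W)
    then show ?thesis by simp
  next
    case False
    then obtain w where w: "w \<in> W" "l c w \<noteq> 0" by auto
    have "W \<subseteq> span (insert w W')"
    proof
      fix v assume v: "v \<in> W"
      have "v - (l c v / l c w) *s w \<in> W'"
        using v w W unfolding W'W
        by (auto simp: subspace_diff subspace_scale linear_form_simps[OF lc])
      then show "v \<in> span (insert w W')"
        unfolding span_insert using span_base by blast
    qed
    then have "dim W \<le> dim (insert w W')" by (rule dim_mono)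
    then show ?thesis by (auto simp: dim_insert split: if_splits)
  qed
  then show ?case using insert by (simp add: W_def W'_def)
qed

lemma dim_sum_le:
  assumes "subspace V" "subspace W" "subspace U" "V \<subseteq> U" "W \<subseteq> U"
  shows "dim V + dim W \<le> dim U + dim (V \<inter> W)"
proof -
  have "{x + y |x y. x \<in> V \<and> y \<in> W} \<subseteq> U" using assms by (auto intro: subspace_add)
  then have "dim {x + y |x y. x \<in> V \<and> y \<in> W} \<le> dim U" by (rule dim_subset)
  then show ?thesis using dim_sums_Int[OF assms(1,2)] by linarith
qed

text \<open>
  Extend a basis of \<open>W\<close> to a basis of the algebra. An element \<open>v\<close> of \<open>V\<close> that is orthogonal to
  the added basis vectors is orthogonal to everything, hence lies in \<open>M\<close>; and the number of added
  vectors is the codimension of \<open>W\<close>.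
\<close>

lemma dim_orthogonal_le:
  assumes l: "linear_form l" and V: "subspace V" and W: "subspace W"
    and orth: "\<And>v w. v \<in> V \<Longrightarrow> w \<in> W \<Longrightarrow> l (v \<cdot> w) = 0"
    and rad: "\<And>x. (\<And>y. l (x \<cdot> y) = 0) \<Longrightarrow> x \<in> M"
  shows "dim V + dim W \<le> dim (V \<inter> M) + dim (UNIV :: 'a set)"
proof -
  obtain B where B: "B \<subseteq> W" "independent B" "W \<subseteq> span B" "card B = dim W"
    using basis_exists by blast
  define C where "C = extend_basis B"
  have C: "B \<subseteq> C" "independent C" "span C = UNIV"
    using B(2) by (auto simp: C_def extend_basis_superset independent_extend_basis)
  have finC: "finite C" using C(2) by (rule finiteI_independent)
  have cardC: "card C = dim (UNIV :: 'a set)" using C by (metis dim_span_eq_card_independent)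
  have "dim V \<le> dim {v \<in> V. \<forall>c\<in>C - B. l (v \<cdot> c) = 0} + card (C - B)"
    using finC V
    by (intro dim_le_dim_kernels[where l = "\<lambda>c v. l (v \<cdot> c)"] linear_formI)
      (auto simp: mult_add_left mult_scale_left linear_form_simps[OF l])
  also have "{v \<in> V. \<forall>c\<in>C - B. l (v \<cdot> c) = 0} \<subseteq> V \<inter> M"
  proof safe
    fix v assume v: "v \<in> V" "\<forall>c\<in>C - B. l (v \<cdot> c) = 0"
    show "v \<in> M"
    proof (rule rad)
      fix y
      have "y \<in> span C" using C by simp
      then show "l (v \<cdot> y) = 0"
      proof (induction rule: span_induct)
        case base
        then show ?case
          by (auto simp: subspace_def mult_add_right mult_scale_right linear_form_simps[OF l])
      next
        case (step c)
        then show ?case using v orth B(1) by blast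
      qed
    qed
  qed
  then have "dim {v \<in> V. \<forall>c\<in>C - B. l (v \<cdot> c) = 0} \<le> dim (V \<inter> M)" by (rule dim_subset)
  moreover have "card (C - B) = dim (UNIV :: 'a set) - dim W"
    using C(1) finC B(4) cardC by (simp add: card_Diff_subset finite_subset)
  moreover have "dim W \<le> dim (UNIV :: 'a set)" by (rule dim_subset) simp
  ultimately show ?thesis by linarith
qed

end

section \<open>Weights of finite decreasing dimension sequences\<close>

text \<open>
  If \<open>f\<close> is the sequence of dimensions of a filtration that only jumps between \<open>- K\<close> and
  \<open>K + 1\<close>, then the first moment is the total weight, the second one the square of the norm.
\<close>

definition moment :: "nat \<Rightarrow> nat \<Rightarrow> (int \<Rightarrow> int) \<Rightarrow> int" where
  "moment r K f = (\<Sum>m\<in>{- int K..int K}. m ^ r * (f m - f (m + 1)))"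

lemma moment_add: "moment r K (\<lambda>n. f n + g n) = moment r K f + moment r K g"
  unfolding moment_def sum.distrib[symmetric] by (intro sum.cong) (simp_all add: algebra_simps)

lemma sum_int_interval_Suc:
  fixes f :: "int \<Rightarrow> int"
  shows "(\<Sum>m\<in>{- int (Suc K)..int (Suc K)}. f m)
           = f (- 1 - int K) + f (int K + 1) + (\<Sum>m\<in>{- int K..int K}. f m)"
    and "(\<Sum>m\<in>{1 - int (Suc K)..int (Suc K)}. f m)
           = f (- int K) + f (int K + 1) + (\<Sum>m\<in>{1 - int K..int K}. f m)"
proof -
  have "{- int (Suc K)..int (Suc K)} = insert (- 1 - int K) (insert (int K + 1) {- int K..int K})"
    "{1 - int (Suc K)..int (Suc K)} = insert (- int K) (insert (int K + 1) {1 - int K..int K})"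
    by auto
  then show "(\<Sum>m\<in>{- int (Suc K)..int (Suc K)}. f m)
           = f (- 1 - int K) + f (int K + 1) + (\<Sum>m\<in>{- int K..int K}. f m)"
    and "(\<Sum>m\<in>{1 - int (Suc K)..int (Suc K)}. f m)
           = f (- int K) + f (int K + 1) + (\<Sum>m\<in>{1 - int K..int K}. f m)"
    by (simp_all only:) (subst sum.insert; auto)+
qed

lemma moment_Suc:
  "moment r (Suc K) f = (- 1 - int K) ^ r * (f (- 1 - int K) - f (- int K))
     + (int K + 1) ^ r * (f (int K + 1) - f (int K + 2)) + moment r K f"
  unfolding moment_def sum_int_interval_Suc by (simp add: algebra_simps)

lemma moment_0: "moment 0 K f = f (- int K) - f (int K + 1)"
proof (induction K)
  case 0
  then show ?case by (simp add: moment_def)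
next
  case (Suc K)
  then show ?case unfolding moment_Suc by (simp add: algebra_simps)
qed

lemma moment_1:
  "moment 1 K f = (\<Sum>m\<in>{1 - int K..int K}. f m) - int K * f (- int K) - int K * f (int K + 1)"
proof (induction K)
  case 0
  then show ?case by (simp add: moment_def)
next
  case (Suc K)
  then show ?case unfolding moment_Suc sum_int_interval_Suc
    by (simp add: algebra_simps del: One_nat_def)
qed

text \<open>
  Summation by parts turns the first moment into a plain sum of \<open>h m\<close>, in which \<open>m\<close> and \<open>1 - m\<close>
  can be paired.
\<close>

lemma moment_1_le_0:
  assumes "\<And>m. h m + h (1 - m) \<le> H" "h (- int K) = H" "h (int K + 1) = 0"
  shows "moment 1 K h \<le> 0"
proof -
  have "(\<Sum>m\<in>{1 - int K..int K}. h (1 - m)) = (\<Sum>m\<in>{1 - int K..int K}. h m)"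
    by (rule sum.reindex_bij_witness[of _ "\<lambda>m. 1 - m" "\<lambda>m. 1 - m"]) auto
  then have "2 * (\<Sum>m\<in>{1 - int K..int K}. h m) = (\<Sum>m\<in>{1 - int K..int K}. h m + h (1 - m))"
    by (simp add: sum.distrib)
  also have "\<dots> \<le> (\<Sum>m\<in>{1 - int K..int K}. H)" by (intro sum_mono assms(1))
  also have "\<dots> = 2 * int K * H" by simp
  finally show ?thesis using assms(2,3) unfolding moment_1 by simp
qed

text \<open>
  The variance of the weights, with denominators cleared: it yields the Cauchy-Schwarz inequality
  together with its case of equality.
\<close>

lemma moment_variance:
  "(\<Sum>m\<in>{- int K..int K}. (moment 0 K g * m - moment 1 K g)\<^sup>2 * (g m - g (m + 1)))
     = moment 0 K g * (moment 0 K g * moment 2 K g - (moment 1 K g)\<^sup>2)" (is "?L = _")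
proof -
  define d W where "d = moment 0 K g" and "W = moment 1 K g"
  have "?L = (\<Sum>m\<in>{- int K..int K}. d\<^sup>2 * (m\<^sup>2 * (g m - g (m + 1)))
      - 2 * d * W * (m * (g m - g (m + 1))) + W\<^sup>2 * (g m - g (m + 1)))"
    unfolding d_def[symmetric] W_def[symmetric]
    by (intro sum.cong refl) (simp add: power2_eq_square algebra_simps)
  also have "\<dots> = d\<^sup>2 * moment 2 K g - 2 * d * W * moment 1 K g + W\<^sup>2 * moment 0 K g"
    unfolding moment_def sum_distrib_left
    by (simp only: sum.distrib sum_subtractf power_0 power_one_right mult_1_left)
  also have "\<dots> = d * (d * moment 2 K g - W\<^sup>2)"
    unfolding d_def[symmetric] W_def[symmetric] by (simp add: power2_eq_square algebra_simps)
  finally show ?thesis by (simp add: d_def W_def)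
qed

lemma constant_if_no_jumps:
  fixes f :: "int \<Rightarrow> int"
  assumes "a \<le> b" "\<And>m. a \<le> m \<Longrightarrow> m < b \<Longrightarrow> f (m + 1) = f m"
  shows "f b = f a"
  using assms
proof (induction b rule: int_ge_induct)
  case base
  then show ?case by simp
next
  case (step i)
  then have "f i = f a" by simp
  moreover have "f (i + 1) = f i" using step by simp
  ultimately show ?case by simp
qed

lemma step_function:
  fixes f :: "int \<Rightarrow> int"
  assumes jumps: "\<And>m. - int K \<le> m \<Longrightarrow> m \<le> int K \<Longrightarrow> m \<noteq> w \<Longrightarrow> f (m + 1) = f m"
    and lo: "\<And>m. m \<le> - int K \<Longrightarrow> f m = c" and hi: "\<And>m. int K < m \<Longrightarrow> f m = 0"
  shows "f n = (if n \<le> w then c else 0)"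
proof -
  have J: "f (m + 1) = f m" if "m \<noteq> w" for m
  proof -
    consider "m < - int K" | "- int K \<le> m" "m \<le> int K" | "int K < m" by linarith
    then show ?thesis
      by cases (use jumps[of m] lo[of m] lo[of "m + 1"] hi[of m] hi[of "m + 1"] that in auto)
  qed
  show ?thesis
  proof (cases "n \<le> w")
    case True
    have "f n = f (min n (- int K))" by (rule constant_if_no_jumps) (use True J in auto)
    then show ?thesis using lo[of "min n (- int K)"] True by simp
  next
    case False
    have "f (max n (int K + 1)) = f n" by (rule constant_if_no_jumps) (use False J in auto)
    then show ?thesis using hi[of "max n (int K + 1)"] False by simp
  qed
qed

text \<open>
  For a filtration of an algebra with ideal \<open>M\<close>, the sequence \<open>g\<close> records the dimensions of the
  intersections with \<open>M\<close>, and \<open>h\<close> those of the images in the quotient by \<open>M\<close>.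
\<close>

locale dimension_sequences =
  fixes g h :: "int \<Rightarrow> int" and d H :: int and K :: nat
  assumes g_dec: "g (m + 1) \<le> g m" and h_dec: "h (m + 1) \<le> h m"
    and low: "m \<le> - int K \<Longrightarrow> g m = d \<and> h m = H"
    and high: "int K < m \<Longrightarrow> g m = 0 \<and> h m = 0"
    and h_sym: "h m + h (1 - m) \<le> H"
    and d_pos: "d > 0"
begin

lemma moment_0_g: "moment 0 K g = d"
  using low[of "- int K"] high[of "int K + 1"] by (simp add: moment_0)

lemma moment_1_le: "moment 1 K (\<lambda>n. g n + h n) \<le> moment 1 K g"
  using moment_1_le_0[of h H K] h_sym low[of "- int K"] high[of "int K + 1"]
  by (simp add: moment_add)

lemma moment_2_h_nonneg: "moment 2 K h \<ge> 0"
  unfolding moment_def using h_dec by (intro sum_nonneg) simp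

lemma cauchy_schwarz_g: "(moment 1 K g)\<^sup>2 \<le> d * moment 2 K g"
proof -
  have "0 \<le> (\<Sum>m\<in>{- int K..int K}. (moment 0 K g * m - moment 1 K g)\<^sup>2 * (g m - g (m + 1)))"
    using g_dec by (intro sum_nonneg) simp
  then have "0 \<le> d * (d * moment 2 K g - (moment 1 K g)\<^sup>2)"
    by (subst (asm) moment_variance) (simp only: moment_0_g)
  then show ?thesis using d_pos by (simp add: zero_le_mult_iff)
qed

text \<open>
  The quotient can only lower the weight and raise the norm, and on \<open>M\<close> the Cauchy-Schwarz
  inequality applies.
\<close>

lemma moment_1_squared_le:
  assumes "moment 1 K (\<lambda>n. g n + h n) \<ge> 0"
  shows "(moment 1 K (\<lambda>n. g n + h n))\<^sup>2 \<le> d * moment 2 K (\<lambda>n. g n + h n)"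
proof -
  have "(moment 1 K (\<lambda>n. g n + h n))\<^sup>2 \<le> (moment 1 K g)\<^sup>2"
    using moment_1_le assms by (rule power_mono)
  also have "\<dots> \<le> d * moment 2 K g" by (rule cauchy_schwarz_g)
  also have "\<dots> \<le> d * moment 2 K (\<lambda>n. g n + h n)"
    using d_pos moment_2_h_nonneg by (simp add: moment_add)
  finally show ?thesis .
qed

text \<open>
  Equality forces the weights of \<open>h\<close> to have zero sum of squares, and the weights of \<open>g\<close> to have
  zero variance.
\<close>

lemma extremal_sequences:
  assumes pos: "moment 1 K (\<lambda>n. g n + h n) > 0"
    and ext: "d * moment 2 K (\<lambda>n. g n + h n) \<le> (moment 1 K (\<lambda>n. g n + h n))\<^sup>2"
  shows "\<exists>w\<ge>1. \<forall>n. g n = (if n \<le> w then d else 0) \<and> h n = (if n \<le> 0 then H else 0)"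
proof -
  have le: "(moment 1 K (\<lambda>n. g n + h n))\<^sup>2 \<le> (moment 1 K g)\<^sup>2"
    using moment_1_le pos by (intro power_mono) auto
  have "d * moment 2 K g + d * moment 2 K h \<le> (moment 1 K g)\<^sup>2"
    using ext le by (simp add: moment_add algebra_simps)
  moreover have "d * moment 2 K h \<ge> 0" using d_pos moment_2_h_nonneg by simp
  ultimately have eq: "(moment 1 K g)\<^sup>2 = d * moment 2 K g" and "d * moment 2 K h = 0"
    using cauchy_schwarz_g by linarith+
  then have h0: "moment 2 K h = 0" using d_pos by simp
  have hj: "h (m + 1) = h m" if "- int K \<le> m" "m \<le> int K" "m \<noteq> 0" for m
  proof -
    have "m\<^sup>2 * (h m - h (m + 1)) = 0"
      using h0 h_dec that unfolding moment_def by (subst (asm) sum_nonneg_eq_0_iff) auto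
    then show ?thesis using that by simp
  qed
  have "(\<Sum>m\<in>{- int K..int K}. (d * m - moment 1 K g)\<^sup>2 * (g m - g (m + 1))) = 0"
    using moment_variance[of K g] eq by (simp add: moment_0_g)
  then have gj0: "(d * m - moment 1 K g)\<^sup>2 * (g m - g (m + 1)) = 0"
    if "- int K \<le> m" "m \<le> int K" for m
    using g_dec that by (subst (asm) sum_nonneg_eq_0_iff) auto
  obtain w where w: "- int K \<le> w" "w \<le> int K" "g (w + 1) \<noteq> g w"
  proof (rule ccontr)
    assume "\<not> thesis"
    then have "\<And>m. - int K \<le> m \<Longrightarrow> m \<le> int K \<Longrightarrow> g (m + 1) = g m" using that by blast
    then have "moment 0 K g = 0" by (simp add: moment_def)
    then show False using moment_0_g d_pos by simp
  qed
  have W: "d * w = moment 1 K g" using gj0[of w] w by simp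
  have gj: "g (m + 1) = g m" if m: "- int K \<le> m" "m \<le> int K" "m \<noteq> w" for m
    using gj0[OF m(1,2), folded W] m(3) d_pos by simp
  have "d * w > 0" using W pos moment_1_le by simp
  then have "w \<ge> 1" using d_pos by (simp add: zero_less_mult_iff)
  moreover have "g n = (if n \<le> w then d else 0)" for n
    using step_function[where w = w and f = g and c = d] gj low high by blast
  moreover have "h n = (if n \<le> 0 then H else 0)" for n
    using step_function[where w = 0 and f = h and c = H] hj low high by blast
  ultimately show ?thesis by blast
qed

end

section \<open>Filtrations and ideals of square zero\<close>

lemma (in fd_algebra) filtration_window:
  assumes "filtration F"
  obtains K where "\<And>m. m \<le> - int K \<Longrightarrow> F m = UNIV" "\<And>m. int K < m \<Longrightarrow> F m = {0}"
proof -
  obtain N1 N2 where N: "\<And>i. i \<le> N1 \<Longrightarrow> F i = UNIV" "\<And>i. N2 \<le> i \<Longrightarrow> F i = {0}"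
    using assms unfolding filtration_def by metis
  show ?thesis
    by (rule that[of "nat (\<bar>N1\<bar> + \<bar>N2\<bar>)"]) (rule N; linarith)+
qed

lemma (in fd_algebra) wt_norm_eq_moments:
  assumes lo: "\<And>m. m \<le> - int K \<Longrightarrow> F m = UNIV" and hi: "\<And>m. int K < m \<Longrightarrow> F m = {0}"
  shows "wt F = moment 1 K (\<lambda>n. int (dim (F n)))"
    and "filt_norm F = sqrt (real_of_int (moment 2 K (\<lambda>n. int (dim (F n)))))"
proof -
  have sub: "weights F \<subseteq> {- int K..int K}"
  proof
    fix m assume m: "m \<in> weights F"
    have "\<not> m < - int K"
    proof
      assume "m < - int K"
      then have "F m = UNIV" "F (m + 1) = UNIV" by (simp_all add: lo)
      then show False using m by (simp add: weights_def)
    qed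
    moreover have "\<not> int K < m"
    proof
      assume "int K < m"
      then have "F m = {0}" "F (m + 1) = {0}" by (simp_all add: hi)
      then show False using m by (simp add: weights_def)
    qed
    ultimately show "m \<in> {- int K..int K}" by auto
  qed
  have "(\<Sum>m\<in>weights F. m ^ r * gr_dim F m) = moment r K (\<lambda>n. int (dim (F n)))" for r
    unfolding moment_def gr_dim_def
    using sub by (intro sum.mono_neutral_left) (auto simp: weights_def)
  from this[of 1] this[of 2] show "wt F = moment 1 K (\<lambda>n. int (dim (F n)))"
    and "filt_norm F = sqrt (real_of_int (moment 2 K (\<lambda>n. int (dim (F n)))))"
    unfolding wt_def filt_norm_def by simp_all
qed

text \<open>
  The last assumption replaces semisimplicity of the quotient by \<open>M\<close>: the Frobenius form of the
  quotient is pulled back to the algebra, where its radical is contained in \<open>M\<close>. In this way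
  neither the quotient algebra nor the filtration induced on it has to be constructed.
\<close>

locale square_zero_ideal = fd_algebra scale mult
  for scale :: "'k::field \<Rightarrow> 'a::ab_group_add \<Rightarrow> 'a" (infixr \<open>*s\<close> 75)
    and mult :: "'a \<Rightarrow> 'a \<Rightarrow> 'a" (infixl \<open>\<cdot>\<close> 70) +
  fixes M :: "'a set"
  assumes subspace_M: "subspace M"
    and ideal_M: "x \<in> M \<Longrightarrow> x \<cdot> y \<in> M" "x \<in> M \<Longrightarrow> y \<cdot> x \<in> M"
    and square_zero: "x \<in> M \<Longrightarrow> y \<in> M \<Longrightarrow> x \<cdot> y = 0"
    and nonzero_M: "M \<noteq> {0}"
    and form: "filtration F \<Longrightarrow> \<exists>l. linear_form l \<and> (\<forall>x\<in>F 1. l x = 0) \<and> (\<forall>x\<in>M. l x = 0) \<and>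
                 (\<forall>x. (\<forall>y. l (x \<cdot> y) = 0) \<longrightarrow> x \<in> M)"
begin

definition ideal_filtration :: "int \<Rightarrow> int \<Rightarrow> 'a set" where
  "ideal_filtration w n = (if n \<le> 0 then UNIV else if n \<le> w then M else {0})"

lemma dim_M_pos: "dim M > 0"
  using nonzero_M subspace_0[OF subspace_M] by auto

lemma filtration_ideal_filtration:
  assumes "w \<ge> 1"
  shows "filtration (ideal_filtration w)"
  unfolding filtration_def
proof (intro conjI allI impI ballI)
  show "subspace (ideal_filtration w m)" for m
    using subspace_M by (auto simp: ideal_filtration_def)
  show "ideal_filtration w j \<subseteq> ideal_filtration w i" if "i \<le> j" for i j
    using that subspace_0[OF subspace_M] by (auto simp: ideal_filtration_def)
  show "x \<cdot> y \<in> ideal_filtration w (i + j)"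
    if "x \<in> ideal_filtration w i" "y \<in> ideal_filtration w j" for i j x y
    using that ideal_M square_zero subspace_0[OF subspace_M]
    by (auto simp: ideal_filtration_def split: if_splits)
  show "\<exists>N. \<forall>i\<le>N. ideal_filtration w i = UNIV"
    by (rule exI[of _ 0]) (auto simp: ideal_filtration_def)
  show "\<exists>N. \<forall>i\<ge>N. ideal_filtration w i = {0}"
    by (rule exI[of _ "w + 1"]) (use assms in \<open>auto simp: ideal_filtration_def\<close>)
qed

lemma ideal_filtration_nontrivial:
  assumes "w \<ge> 1"
  shows "ideal_filtration w \<noteq> trivial_filtration"
proof
  assume "ideal_filtration w = trivial_filtration"
  then have "ideal_filtration w 1 = trivial_filtration 1" by simp
  then show False using assms nonzero_M by (simp add: ideal_filtration_def trivial_filtration_def)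
qed

lemma ideal_filtration_wt_\<nu>:
  assumes w: "w \<ge> 1"
  shows "wt (ideal_filtration w) > 0" and "\<nu> (ideal_filtration w) = - sqrt (dim M)"
proof -
  define K where "K = nat w"
  have K: "int K = w" using w by (simp add: K_def)
  define f where "f n = int (dim (ideal_filtration w n))" for n
  have jump: "m ^ r * (f m - f (m + 1)) = (if m = w then w ^ r * int (dim M) else 0)"
    if "r > 0" for m r
    using w that by (auto simp: f_def ideal_filtration_def)
  have mom: "moment r K f = w ^ r * int (dim M)" if "r > 0" for r
    unfolding moment_def jump[OF that] using w by (simp add: K)
  have eq: "wt (ideal_filtration w) = moment 1 K f"
    "filt_norm (ideal_filtration w) = sqrt (real_of_int (moment 2 K f))"
    unfolding f_def
    using wt_norm_eq_moments[of K "ideal_filtration w"] w by (auto simp: ideal_filtration_def K)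
  have wt: "wt (ideal_filtration w) = w * int (dim M)"
    unfolding eq using mom[of 1] by simp
  then show "wt (ideal_filtration w) > 0" using w dim_M_pos by simp
  have norm: "filt_norm (ideal_filtration w) = real_of_int w * sqrt (dim M)"
    unfolding eq using w mom[of 2] by (simp add: real_sqrt_mult)
  show "\<nu> (ideal_filtration w) = - sqrt (dim M)"
    unfolding \<nu>_def wt norm using w dim_M_pos by (simp add: real_div_sqrt)
qed

text \<open>
  Since \<open>F m \<cdot> F (1 - m)\<close> lies in \<open>F 1\<close>, the form makes \<open>F m\<close> orthogonal to \<open>F (1 - m) + M\<close>.
  This expresses that the images of \<open>F m\<close> and \<open>F (1 - m)\<close> in the quotient by \<open>M\<close> have
  dimensions adding up to at most that of the quotient.
\<close>

lemma filtration_dim_symmetry: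
  assumes F: "filtration F"
  shows "dim (F m) + dim (F (1 - m)) + dim M
           \<le> dim (F m \<inter> M) + dim (F (1 - m) \<inter> M) + dim (UNIV :: 'a set)"
proof -
  obtain l where l: "linear_form l" "\<And>x. x \<in> F 1 \<Longrightarrow> l x = 0" "\<And>x. x \<in> M \<Longrightarrow> l x = 0"
    "\<And>x. (\<And>y. l (x \<cdot> y) = 0) \<Longrightarrow> x \<in> M"
    using form[OF F] by blast
  have sub: "\<And>m. subspace (F m)" and mult: "\<And>i j x y. x \<in> F i \<Longrightarrow> y \<in> F j \<Longrightarrow> x \<cdot> y \<in> F (i + j)"
    using F by (auto simp: filtration_def)
  define W where "W = {x + y |x y. x \<in> F (1 - m) \<and> y \<in> M}"
  have "dim (F m) + dim W \<le> dim (F m \<inter> M) + dim (UNIV :: 'a set)"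
  proof (rule dim_orthogonal_le[OF l(1) sub])
    show "subspace W" unfolding W_def by (intro subspace_sums sub subspace_M)
    fix v w assume v: "v \<in> F m" and "w \<in> W"
    then obtain x y where w: "w = x + y" "x \<in> F (1 - m)" "y \<in> M" by (auto simp: W_def)
    have "v \<cdot> x \<in> F 1" using mult[OF v w(2)] by simp
    then show "l (v \<cdot> w) = 0"
      using w ideal_M l(2,3) by (simp add: mult_add_right linear_form_simps[OF l(1)])
  qed (use l(4) in blast)
  moreover have "dim W + dim (F (1 - m) \<inter> M) = dim (F (1 - m)) + dim M"
    unfolding W_def by (rule dim_sums_Int[OF sub subspace_M])
  ultimately show ?thesis by linarith
qed

lemma filtration_dimension_sequences:
  assumes F: "filtration F"
    and lo: "\<And>m. m \<le> - int K \<Longrightarrow> F m = UNIV" and hi: "\<And>m. int K < m \<Longrightarrow> F m = {0}"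
  shows "dimension_sequences (\<lambda>n. int (dim (F n \<inter> M)))
           (\<lambda>n. int (dim (F n)) - int (dim (F n \<inter> M)))
           (int (dim M)) (int (dim (UNIV :: 'a set)) - int (dim M)) K"
proof
  have sub: "\<And>m. subspace (F m)" and dec: "\<And>m. F (m + 1) \<subseteq> F m"
    using F by (auto simp: filtration_def)
  fix m
  have "F (m + 1) \<inter> M \<subseteq> F m \<inter> M" using dec[of m] by blast
  then show "int (dim (F (m + 1) \<inter> M)) \<le> int (dim (F m \<inter> M))" by (simp add: dim_subset)
  have "dim (F (m + 1)) + dim (F m \<inter> M) \<le> dim (F m) + dim (F (m + 1) \<inter> (F m \<inter> M))"
    by (intro dim_sum_le sub subspace_inter subspace_M dec) auto
  moreover have "F (m + 1) \<inter> (F m \<inter> M) = F (m + 1) \<inter> M" using dec[of m] by blast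
  ultimately show "int (dim (F (m + 1))) - int (dim (F (m + 1) \<inter> M))
      \<le> int (dim (F m)) - int (dim (F m \<inter> M))" by simp
  have "dim (F m) + dim (F (1 - m)) + dim M
           \<le> dim (F m \<inter> M) + dim (F (1 - m) \<inter> M) + dim (UNIV :: 'a set)"
    by (rule filtration_dim_symmetry[OF F])
  then show "int (dim (F m)) - int (dim (F m \<inter> M)) + (int (dim (F (1 - m))) - int (dim (F (1 - m) \<inter> M)))
      \<le> int (dim (UNIV :: 'a set)) - int (dim M)" by linarith
  show "int (dim (F m \<inter> M)) = int (dim M) \<and>
      int (dim (F m)) - int (dim (F m \<inter> M)) = int (dim (UNIV :: 'a set)) - int (dim M)"
    if "m \<le> - int K"
    using lo[OF that] by simp
  show "int (dim (F m \<inter> M)) = 0 \<and> int (dim (F m)) - int (dim (F m \<inter> M)) = 0" if "int K < m"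
    using hi[OF that] subspace_0[OF subspace_M] by simp
  show "0 < int (dim M)" using dim_M_pos by simp
qed

text \<open>
  By the estimates on moments, \<open>wt F \<le> sqrt (dim M) * filt_norm F\<close>. In the case of equality the
  dimensions of \<open>F n \<inter> M\<close> and of \<open>F n\<close> are known for all \<open>n\<close>, and they determine \<open>F n\<close>.
\<close>

lemma \<nu>_bound:
  assumes F: "filtration F"
  shows "- sqrt (dim M) \<le> \<nu> F"
    and "\<nu> F \<le> - sqrt (dim M) \<Longrightarrow> \<exists>w\<ge>1. F = ideal_filtration w"
proof -
  obtain K where lo: "\<And>m. m \<le> - int K \<Longrightarrow> F m = UNIV" and hi: "\<And>m. int K < m \<Longrightarrow> F m = {0}"
    using filtration_window[OF F] by metis
  interpret s: dimension_sequences "\<lambda>n. int (dim (F n \<inter> M))"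
      "\<lambda>n. int (dim (F n)) - int (dim (F n \<inter> M))"
      "int (dim M)" "int (dim (UNIV :: 'a set)) - int (dim M)" K
    by (rule filtration_dimension_sequences[OF F lo hi])
  define d Q where "d = dim M" and "Q = moment 2 K (\<lambda>n. int (dim (F n)))"
  have d: "d > 0" using dim_M_pos by (simp add: d_def)
  have sum: "(\<lambda>n. int (dim (F n \<inter> M)) + (int (dim (F n)) - int (dim (F n \<inter> M))))
      = (\<lambda>n. int (dim (F n)))" by simp
  have wt: "wt F = moment 1 K (\<lambda>n. int (dim (F n)))"
    by (rule wt_norm_eq_moments(1)[OF lo hi])
  have norm: "filt_norm F = sqrt (real_of_int Q)"
    unfolding Q_def by (rule wt_norm_eq_moments(2)[OF lo hi])
  have bound: "(wt F)\<^sup>2 \<le> int d * Q" if "wt F \<ge> 0"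
    using s.moment_1_squared_le that unfolding sum wt d_def Q_def .
  have ext: "\<exists>w\<ge>1. \<forall>n. int (dim (F n \<inter> M)) = (if n \<le> w then int (dim M) else 0) \<and>
      int (dim (F n)) - int (dim (F n \<inter> M))
        = (if n \<le> 0 then int (dim (UNIV :: 'a set)) - int (dim M) else 0)"
    if "wt F > 0" "int d * Q \<le> (wt F)\<^sup>2"
    using s.extremal_sequences that unfolding sum wt d_def Q_def by blast
  have Q0: "Q \<ge> 0" unfolding Q_def moment_def
  proof (rule sum_nonneg)
    fix m show "0 \<le> m\<^sup>2 * (int (dim (F m)) - int (dim (F (m + 1))))"
      using F by (simp add: filtration_def dim_subset)
  qed
  show "- sqrt (dim M) \<le> \<nu> F"
  proof (cases "wt F > 0")
    case False
    have "\<nu> F \<ge> 0" using False Q0 unfolding \<nu>_def norm by (simp add: divide_nonpos_nonneg)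
    moreover have "- sqrt (dim M) \<le> 0" by simp
    ultimately show ?thesis by linarith
  next
    case True
    then have "(wt F)\<^sup>2 \<le> int d * Q" using bound by simp
    moreover have "(wt F)\<^sup>2 > 0" using True by simp
    ultimately have "int d * Q > 0" by linarith
    then have Q: "Q > 0" using d by (simp add: zero_less_mult_iff)
    have "real_of_int ((wt F)\<^sup>2) \<le> real_of_int (int d * Q)"
      using \<open>(wt F)\<^sup>2 \<le> int d * Q\<close> by (simp only: of_int_le_iff)
    then have "real_of_int (wt F) \<le> sqrt (real d * real_of_int Q)"
      by (intro real_le_rsqrt) simp
    then show ?thesis
      using Q unfolding \<nu>_def norm d_def[symmetric]
      by (simp add: field_simps real_sqrt_mult)
  qed
  assume le: "\<nu> F \<le> - sqrt (dim M)"
  have "Q > 0"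
  proof (rule ccontr)
    assume "\<not> Q > 0"
    then have "wt F \<le> 0 \<or> (wt F)\<^sup>2 \<le> 0"
      using bound d by (metis linorder_not_less mult_nonneg_nonpos of_nat_0_le_iff order.trans nle_le)
    then have "wt F \<le> 0" by auto
    moreover have "sqrt (real_of_int Q) \<le> 0" using \<open>\<not> Q > 0\<close> by simp
    ultimately have "\<nu> F = 0" using Q0 unfolding \<nu>_def norm by simp
    then show False using le d by (simp add: d_def del: dim_eq_0)
  qed
  then have root: "sqrt (real d * real_of_int Q) \<le> real_of_int (wt F)"
    using le unfolding \<nu>_def norm d_def[symmetric]
    by (simp add: field_simps real_sqrt_mult)
  have dQ: "real d * real_of_int Q > 0" using d \<open>Q > 0\<close> by simp
  then have pos: "real_of_int (wt F) > 0" using root real_sqrt_gt_zero[OF dQ] by linarith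
  have "real d * real_of_int Q \<le> (real_of_int (wt F))\<^sup>2"
    using root pos sqrt_le_D by blast
  then have "real_of_int (int d * Q) \<le> real_of_int ((wt F)\<^sup>2)" by simp
  then have "int d * Q \<le> (wt F)\<^sup>2" by (simp only: of_int_le_iff)
  moreover have "wt F > 0" using pos by simp
  ultimately obtain w where w: "w \<ge> 1"
    and gn: "\<And>n. int (dim (F n \<inter> M)) = (if n \<le> w then int (dim M) else 0)"
    and hn: "\<And>n. int (dim (F n)) - int (dim (F n \<inter> M))
        = (if n \<le> 0 then int (dim (UNIV :: 'a set)) - int (dim M) else 0)"
    using ext by blast
  have sub: "\<And>m. subspace (F m)" using F by (auto simp: filtration_def)
  have "F n = ideal_filtration w n" for n
  proof -
    consider "n \<le> 0" | "1 \<le> n" "n \<le> w" | "w < n" by linarith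
    then show ?thesis
    proof cases
      case 1
      then have "dim (F n) = dim (UNIV :: 'a set)" using gn[of n] hn[of n] w by simp
      then have "F n = UNIV" using subspace_dim_equal[OF sub subspace_UNIV, of n] by simp
      then show ?thesis using 1 by (simp add: ideal_filtration_def)
    next
      case 2
      have "dim (F n \<inter> M) = dim M" "dim (F n \<inter> M) = dim (F n)"
        using gn[of n] hn[of n] 2 by simp_all
      then have "F n \<inter> M = M" "F n \<inter> M = F n"
        using subspace_dim_equal[OF subspace_inter[OF sub subspace_M] subspace_M]
          subspace_dim_equal[OF subspace_inter[OF sub subspace_M] sub] by simp_all
      then have "F n = M" by blast
      then show ?thesis using 2 by (simp add: ideal_filtration_def)
    next
      case 3
      then have "dim (F n) = 0" using gn[of n] hn[of n] w by simp
      then have "F n = {0}" using subspace_0[OF sub, of n] by auto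
      then show ?thesis using 3 w by (simp add: ideal_filtration_def)
    qed
  qed
  then show "\<exists>w\<ge>1. F = ideal_filtration w" using w by blast
qed

theorem canonical_filtration_iff:
  "canonical_filtration F \<longleftrightarrow> (\<exists>w\<ge>1. F = ideal_filtration w)"
proof -
  have "\<not> semistable"
    using filtration_ideal_filtration[of 1] ideal_filtration_wt_\<nu>(1)[of 1]
    by (auto simp: semistable_def not_le intro!: exI[of _ "ideal_filtration 1"])
  then have can: "canonical_filtration F \<longleftrightarrow> filtration F \<and> F \<noteq> trivial_filtration \<and>
      (\<forall>G. filtration G \<and> G \<noteq> trivial_filtration \<longrightarrow> \<nu> F \<le> \<nu> G)"
    by (simp add: canonical_filtration_def)
  show ?thesis
  proof
    assume F: "canonical_filtration F"
    then have "\<nu> F \<le> \<nu> (ideal_filtration 1)"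
      using can filtration_ideal_filtration[of 1] ideal_filtration_nontrivial[of 1] by simp
    then show "\<exists>w\<ge>1. F = ideal_filtration w"
      using \<nu>_bound(2) F can ideal_filtration_wt_\<nu>(2)[of 1] by simp
  next
    assume "\<exists>w\<ge>1. F = ideal_filtration w"
    then show "canonical_filtration F"
      using can filtration_ideal_filtration ideal_filtration_nontrivial ideal_filtration_wt_\<nu>(2)
        \<nu>_bound(1) by auto
  qed
qed

text \<open>
  A rescaling factor \<open>c < 1\<close> is impossible: the filtration would have to be both \<open>M\<close> and \<open>0\<close> at
  the index 1. For \<open>c \<ge> 1\<close> the integer part of \<open>c\<close> is the weight of the rescaled filtration.
\<close>

lemma rescaling_ideal_filtration_iff:
  "rescaling (ideal_filtration 1) F \<longleftrightarrow> (\<exists>w\<ge>1. F = ideal_filtration w)"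
proof
  assume "rescaling (ideal_filtration 1) F"
  then obtain c where c: "c > 0" "\<And>t::real. F \<lceil>c * t\<rceil> = ideal_filtration 1 \<lceil>t\<rceil>"
    by (auto simp: rescaling_def)
  have F: "F n = ideal_filtration 1 \<lceil>real_of_int n / c\<rceil>" for n
    using c(2)[of "real_of_int n / c"] c(1) by simp
  have "c \<ge> 1"
  proof (rule ccontr)
    assume "\<not> c \<ge> 1"
    then have "\<lceil>c\<rceil> = 1" using c(1) by (simp add: ceiling_eq_iff)
    then have "F 1 = M" using c(2)[of 1] by (simp add: ideal_filtration_def)
    moreover have "\<lceil>real_of_int 1 / c\<rceil> > 1"
      using \<open>\<not> c \<ge> 1\<close> c(1) by (simp add: less_ceiling_iff)
    moreover have "ideal_filtration 1 n = {0}" if "n > 1" for n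
      using that by (simp add: ideal_filtration_def)
    ultimately have "F 1 = {0}" using F[of 1] by metis
    then show False using \<open>F 1 = M\<close> nonzero_M by simp
  qed
  moreover have "F n = ideal_filtration \<lfloor>c\<rfloor> n" for n
  proof -
    have "\<lceil>real_of_int n / c\<rceil> \<le> 0 \<longleftrightarrow> n \<le> 0"
      using c(1) by (simp add: ceiling_le_iff divide_le_0_iff)
    moreover have "\<lceil>real_of_int n / c\<rceil> \<le> 1 \<longleftrightarrow> n \<le> \<lfloor>c\<rfloor>"
      using c(1) by (simp add: ceiling_le_iff le_floor_iff)
    ultimately show ?thesis unfolding F by (simp add: ideal_filtration_def)
  qed
  ultimately show "\<exists>w\<ge>1. F = ideal_filtration w"
    by (intro exI[of _ "\<lfloor>c\<rfloor>"]) (auto simp: le_floor_iff)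
next
  assume "\<exists>w\<ge>1. F = ideal_filtration w"
  then obtain w where w: "w \<ge> 1" "F = ideal_filtration w" by auto
  show "rescaling (ideal_filtration 1) F"
    unfolding rescaling_def
  proof (intro exI[of _ "real_of_int w"] conjI allI)
    show "0 < real_of_int w" using w by simp
    fix t :: real
    have "\<lceil>real_of_int w * t\<rceil> \<le> 0 \<longleftrightarrow> \<lceil>t\<rceil> \<le> 0"
      using w by (simp add: ceiling_le_iff mult_le_0_iff)
    moreover have "\<lceil>real_of_int w * t\<rceil> \<le> w \<longleftrightarrow> \<lceil>t\<rceil> \<le> 1"
      using w by (simp add: ceiling_le_iff)
    ultimately show "F \<lceil>real_of_int w * t\<rceil> = ideal_filtration 1 \<lceil>t\<rceil>"
      by (simp add: w ideal_filtration_def)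
  qed
qed

end

section \<open>Triangular algebras\<close>

text \<open>
  A product of \<open>r\<close> elements of \<open>F 1\<close> with an arbitrary element lies in \<open>F (r - K)\<close> when \<open>F\<close> is
  everything at \<open>- K\<close>, so it vanishes for large \<open>r\<close>. Taking images under a homomorphism \<open>p\<close>
  transfers this.
\<close>

lemma (in fd_algebra) filtration_image_acts_nilpotently:
  fixes mult' :: "'b::ab_group_add \<Rightarrow> 'b \<Rightarrow> 'b"
  assumes F: "filtration F" and alg: "assoc_algebra scale' mult'"
    and hom: "\<And>x y. p (x \<cdot> y) = mult' (p x) (p y)" and "surj p" "p 0 = 0"
  shows "assoc_algebra.acts_nilpotently mult' (p ` F 1) UNIV"
proof -
  obtain K where lo: "\<And>m. m \<le> - int K \<Longrightarrow> F m = UNIV" and hi: "\<And>m. int K < m \<Longrightarrow> F m = {0}"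
    using filtration_window[OF F] by metis
  have mult: "\<And>i j x y. x \<in> F i \<Longrightarrow> y \<in> F j \<Longrightarrow> x \<cdot> y \<in> F (i + j)"
    using F by (auto simp: filtration_def)
  have "foldr mult' xs y \<in> p ` F (int (length xs) - int K)" if "set xs \<subseteq> p ` F 1" for xs y
    using that
  proof (induction xs)
    case Nil
    then show ?case using \<open>surj p\<close> by (simp add: lo)
  next
    case (Cons x xs)
    then obtain u v where u: "u \<in> F 1" "x = p u"
      and v: "v \<in> F (int (length xs) - int K)" "foldr mult' xs y = p v" by auto
    have "u \<cdot> v \<in> F (int (length (x # xs)) - int K)"
      using mult[OF u(1) v(1)] by (simp add: algebra_simps)
    then show ?case using u v by (auto simp flip: hom)
  qed
  then have "foldr mult' xs y = 0" if "set xs \<subseteq> p ` F 1" "length xs = 2 * K + 1" for xs y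
    using that hi[of "int (length xs) - int K"] \<open>p 0 = 0\<close> by fastforce
  then show ?thesis unfolding assoc_algebra.acts_nilpotently_def[OF alg] by blast
qed

text \<open>
  The images of \<open>F 1\<close> in the two diagonal blocks are nilpotent, so each block carries a Frobenius
  form vanishing there. The sum of the two forms ignores the off-diagonal entry, and its radical is
  \<open>tri_M\<close>.
\<close>

lemma (in bimodule) square_zero_ideal_tri:
  assumes fd: "fin_dim scaleA" "fin_dim scaleM" "fin_dim scaleB"
    and ss: "A.semisimple" "B.semisimple" and "\<exists>m::'m. m \<noteq> 0"
  shows "square_zero_ideal (tri_scale scaleA scaleM scaleB) (tri_mult multA lact ract multB) tri_M"
proof -
  interpret fA: fd_algebra scaleA multA by unfold_locales (rule fd)
  interpret fB: fd_algebra scaleB multB by unfold_locales (rule fd)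
  interpret T: fd_algebra "tri_scale scaleA scaleM scaleB" "tri_mult multA lact ract multB"
    by (rule fd_algebra_tri[OF fd])
  have act0: "lact 0 m = 0" "lact a 0 = 0" "ract 0 b = 0" "ract m 0 = 0" for a m b
    using lact_add_left[of 0 0 m] lact_add_right[of a 0 0] ract_add_left[of 0 0 b]
      ract_add_right[of m 0 0] by simp_all
  have zero: "(0 :: 'a \<times> 'm \<times> 'b) = (0, 0, 0)" by (simp add: zero_prod_def)
  note tri = tri_M_def tri_scale_def tri_mult_def zero act0
  show ?thesis
  proof
    show "T.subspace tri_M" unfolding T.subspace_def by (auto simp: tri)
    show "tri_mult multA lact ract multB x y \<in> tri_M" "tri_mult multA lact ract multB y x \<in> tri_M"
      if "x \<in> tri_M" for x y
      using that by (cases y; auto simp: tri)+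
    show "tri_mult multA lact ract multB x y = 0" if "x \<in> tri_M" "y \<in> tri_M" for x y
      using that by (auto simp: tri)
    show "(tri_M :: ('a \<times> 'm \<times> 'b) set) \<noteq> {0}"
    proof -
      obtain m :: 'm where "m \<noteq> 0" using assms(6) by blast
      then have "(0, m, 0) \<in> (tri_M :: ('a \<times> 'm \<times> 'b) set)" "(0, m, 0) \<noteq> (0 :: 'a \<times> 'm \<times> 'b)"
        by (auto simp: tri)
      then show ?thesis by blast
    qed
    fix F assume F: "T.filtration F"
    have "A.acts_nilpotently (fst ` F 1) UNIV"
      by (rule T.filtration_image_acts_nilpotently[OF F A.assoc_algebra_axioms])
        (auto simp: tri_mult_def)
    then obtain p where p: "A.linear_form p" "\<And>x. x \<in> fst ` F 1 \<Longrightarrow> p x = 0"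
      "\<And>x. (\<And>y. p (multA x y) = 0) \<Longrightarrow> x = 0"
      using fA.frobenius_form_vanishing_on_nilpotent[of UNIV "fst ` F 1"]
        A.semisimple_imp_semiprime[OF ss(1)] by (auto simp: A.subalgebra_def)
    have surj: "surj (snd \<circ> snd :: 'a \<times> 'm \<times> 'b \<Rightarrow> 'b)" by (intro comp_surj) simp_all
    have "B.acts_nilpotently ((snd \<circ> snd) ` F 1) UNIV"
      by (rule T.filtration_image_acts_nilpotently[OF F B.assoc_algebra_axioms _ surj])
        (auto simp: tri_mult_def)
    then obtain q where q: "B.linear_form q" "\<And>x. x \<in> (snd \<circ> snd) ` F 1 \<Longrightarrow> q x = 0"
      "\<And>x. (\<And>y. q (multB x y) = 0) \<Longrightarrow> x = 0"
      using fB.frobenius_form_vanishing_on_nilpotent[of UNIV "(snd \<circ> snd) ` F 1"]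
        B.semisimple_imp_semiprime[OF ss(2)] by (auto simp: B.subalgebra_def)
    note lin = A.linear_form_simps[OF p(1)] B.linear_form_simps[OF q(1)]
    define l where "l x = p (fst x) + q (snd (snd x))" for x :: "'a \<times> 'm \<times> 'b"
    have "T.linear_form l"
      by (rule T.linear_formI) (auto simp: l_def lin tri_scale_def algebra_simps)
    moreover have "\<forall>x\<in>F 1. l x = 0" using p(2) q(2) by (auto simp: l_def)
    moreover have "\<forall>x\<in>tri_M. l x = 0" by (auto simp: l_def tri_M_def lin)
    moreover have "x \<in> tri_M" if x: "\<And>y. l (tri_mult multA lact ract multB x y) = 0" for x
    proof -
      obtain a m b where abm: "x = (a, m, b)" by (cases x) auto
      have "p (multA a a') = 0" for a'
        using x[of "(a', 0, 0)"] by (simp add: abm l_def tri_mult_def lin)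
      moreover have "q (multB b b') = 0" for b'
        using x[of "(0, 0, b')"] by (simp add: abm l_def tri_mult_def lin)
      ultimately have "a = 0" "b = 0" using p(3) q(3) by blast+
      then show ?thesis by (simp add: abm tri_M_def)
    qed
    ultimately show "\<exists>l. T.linear_form l \<and> (\<forall>x\<in>F 1. l x = 0) \<and> (\<forall>x\<in>tri_M. l x = 0) \<and>
        (\<forall>x. (\<forall>y. l (tri_mult multA lact ract multB x y) = 0) \<longrightarrow> x \<in> tri_M)"
      by blast
  qed
qed

theorem proposition4p11:
  fixes scaleA :: "'k::field \<Rightarrow> 'a::ab_group_add \<Rightarrow> 'a" and multA :: "'a \<Rightarrow> 'a \<Rightarrow> 'a"
    and scaleB :: "'k \<Rightarrow> 'b::ab_group_add \<Rightarrow> 'b" and multB :: "'b \<Rightarrow> 'b \<Rightarrow> 'b"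
    and scaleM :: "'k \<Rightarrow> 'm::ab_group_add \<Rightarrow> 'm"
    and lact :: "'a \<Rightarrow> 'm \<Rightarrow> 'm" and ract :: "'m \<Rightarrow> 'b \<Rightarrow> 'm"
  assumes "perfect_field TYPE('k)"
    and "fd_algebra scaleA multA" and "assoc_algebra.semisimple multA"
    and "fd_algebra scaleB multB" and "assoc_algebra.semisimple multB"
    and "bimodule scaleA multA scaleB multB scaleM lact ract"
    and "fin_dim scaleM" and "\<exists>m::'m. m \<noteq> 0"
  shows "\<forall>F. fd_algebra.canonical_filtration
               (tri_scale scaleA scaleM scaleB) (tri_mult multA lact ract multB) F \<longleftrightarrow>
             rescaling (\<lambda>n. if n \<le> 0 then UNIV else if n = 1 then tri_M else {0}) F"
proof -
  interpret bimodule scaleA multA scaleB multB scaleM lact ract by (fact assms)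
  interpret T: square_zero_ideal "tri_scale scaleA scaleM scaleB"
      "tri_mult multA lact ract multB" tri_M
    using assms by (intro square_zero_ideal_tri) (auto simp: fd_algebra.fin_dim)
  have "(\<lambda>n. if n \<le> 0 then UNIV else if n = 1 then tri_M else {0}) = T.ideal_filtration 1"
    by (auto simp: fun_eq_iff T.ideal_filtration_def)
  then show ?thesis
    by (simp only: T.canonical_filtration_iff T.rescaling_ideal_filtration_iff simp_thms)
qed

end
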